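(* Let $H$ be a separable (real) Hilbert space. Assume that 1. $F:H\to\mathbb{R}\cup\{+\infty\}$ is a weakly lower semi-continuous and convex function with sub-differential $\partial F$ such that the domain of $\partial F$ is dense in $H$; 2. $G:H\to\mathbb{R}$ is concave, continuous and Gateaux-differentiable with continuous linear Gateaux derivative, i.e. for every $x\in H$ there exists a vector $\nabla G(x)\in H$ such that $$\lim_{t\to0}\frac{G(x+tv)-G(x)}t=\langle\nabla G(x),v\rangle\qquad\text{for all }v\in H.$$ Let $(x_0,v_0)\in H\times H$, $\eta,\tau>0$ and $\rho\in(0,1]$. Then there exists a unique sequence $(x_n,v_n)_{n\ge0}$ in $H\times H$ with the given initial element $(x_0,v_0)$ which obeys, for all $n\ge0$, the time-stepping scheme $$\frac{x_n+\tau v_n-x_{n+1}}\eta-\nabla G(x_n)\in\partial F(x_{n+1}),\qquad v_{n+1}=\rho\,(v_n-\tau g_n),$$ where $g_n=\nabla G(x_n)+s_{n+1}\in\nabla G(x_n)+\partial F(x_{n+1})$ is formed with the same element $s_{n+1}=\frac{x_n+\tau v_n-x_{n+1}}\eta-\nabla G(x_n)$ of the sub-differential as in the inclusion. Additionally, the total energy $$e_n=(F+G)(x_n)+\frac1{2\rho^2}\,\|v_n\|^2$$ satisfies, for all $n\ge0$, $$e_{n+1}\le e_n-\frac12\,(\rho^{-2}-1)\,\|v_n\|^2+\left(\frac{\tau^2}2-\eta\right)\|g_n\|^2.$$ In particular, if $\eta\ge\tau^2/2$, the energy $e_n$ is monotonically decreasing (non-increasing) in $n$.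
   Context: The sub-differential of $F$ at $z$ with $F(z)<\infty$ is $\partial F(z)=\{s\in H: F(y)\ge F(z)+\langle s,y-z\rangle\ \text{for all }y\in H\}$, and $\partial F(z)=\emptyset$ if $F(z)=+\infty$; the domain of $\partial F$ is $\{z\in H:\partial F(z)\neq\emptyset\}$. If $F(x_0)=+\infty$, then $e_0=+\infty$ and the inequality for $n=0$ is understood in $\mathbb{R}\cup\{+\infty\}$. *)

theory Defs
  imports "HOL-Analysis.Analysis"
begin

definition weak_topology :: "'a::real_normed_vector topology" where
  "weak_topology =
     topology_generated_by {f -` U | (f :: 'a \<Rightarrow> real) U. bounded_linear f \<and> open U}"

definition lower_semicontinuous_map :: "'a topology \<Rightarrow> ('a \<Rightarrow> ereal) \<Rightarrow> bool" where
  "lower_semicontinuous_map X F \<longleftrightarrow> (\<forall>c. openin X {x \<in> topspace X. c < F x})"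

(* Intended for functions that never take the value -\<infinity>, so that no \<infinity> - \<infinity> can occur.
   The library's convex_on only covers real-valued functions. *)
definition ereal_convex :: "('a::real_vector \<Rightarrow> ereal) \<Rightarrow> bool" where
  "ereal_convex F \<longleftrightarrow>
     (\<forall>x y t. 0 < t \<and> t < 1 \<longrightarrow>
        F ((1 - t) *\<^sub>R x + t *\<^sub>R y) \<le> ereal (1 - t) * F x + ereal t * F y)"

definition subdifferential :: "('a::real_inner \<Rightarrow> ereal) \<Rightarrow> 'a \<Rightarrow> 'a set" where
  "subdifferential F z =
     (if F z = \<infinity> then {} else {s. \<forall>y. F y \<ge> F z + ereal (inner s (y - z))})"

definition subdifferential_domain :: "('a::real_inner \<Rightarrow> ereal) \<Rightarrow> 'a set" where
  "subdifferential_domain F = {z. subdifferential F z \<noteq> {}}"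

definition has_gateaux_gradient :: "('a::real_inner \<Rightarrow> real) \<Rightarrow> 'a \<Rightarrow> 'a \<Rightarrow> bool" where
  "has_gateaux_gradient G d x \<longleftrightarrow>
     (\<forall>v. ((\<lambda>t. (G (x + t *\<^sub>R v) - G x) / t) \<longlongrightarrow> inner d v) (at 0))"

(* the element s_{n+1} of the sub-differential at x_{n+1} singled out by the scheme *)
definition scheme_subgradient ::
  "('a::real_inner \<Rightarrow> 'a) \<Rightarrow> real \<Rightarrow> real \<Rightarrow> (nat \<Rightarrow> 'a) \<Rightarrow> (nat \<Rightarrow> 'a) \<Rightarrow> nat \<Rightarrow> 'a" where
  "scheme_subgradient gradG \<eta> \<tau> x v n =
     (x n + \<tau> *\<^sub>R v n - x (Suc n)) /\<^sub>R \<eta> - gradG (x n)"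

(* the full generalized gradient g_n *)
definition scheme_gradient ::
  "('a::real_inner \<Rightarrow> 'a) \<Rightarrow> real \<Rightarrow> real \<Rightarrow> (nat \<Rightarrow> 'a) \<Rightarrow> (nat \<Rightarrow> 'a) \<Rightarrow> nat \<Rightarrow> 'a" where
  "scheme_gradient gradG \<eta> \<tau> x v n = gradG (x n) + scheme_subgradient gradG \<eta> \<tau> x v n"

definition time_stepping_scheme ::
  "('a::real_inner \<Rightarrow> ereal) \<Rightarrow> ('a \<Rightarrow> 'a) \<Rightarrow> real \<Rightarrow> real \<Rightarrow> real \<Rightarrow>
   (nat \<Rightarrow> 'a) \<Rightarrow> (nat \<Rightarrow> 'a) \<Rightarrow> bool" where
  "time_stepping_scheme F gradG \<eta> \<tau> \<rho> x v \<longleftrightarrow>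
     (\<forall>n. scheme_subgradient gradG \<eta> \<tau> x v n \<in> subdifferential F (x (Suc n)) \<and>
          v (Suc n) = \<rho> *\<^sub>R (v n - \<tau> *\<^sub>R scheme_gradient gradG \<eta> \<tau> x v n))"

definition total_energy ::
  "('a::real_inner \<Rightarrow> ereal) \<Rightarrow> ('a \<Rightarrow> real) \<Rightarrow> real \<Rightarrow>
   (nat \<Rightarrow> 'a) \<Rightarrow> (nat \<Rightarrow> 'a) \<Rightarrow> nat \<Rightarrow> ereal" where
  "total_energy F G \<rho> x v n = F (x n) + ereal (G (x n)) + ereal (1 / (2 * \<rho>\<^sup>2) * (norm (v n))\<^sup>2)"

end

theory Submission
  imports Defs
begin

text \<open>
  One step of the scheme is an implicit Euler (proximal) step in \<open>F\<close>: with
  \<open>y = x\<^sub>n + \<tau> v\<^sub>n - \<eta> \<nabla>G(x\<^sub>n)\<close>, the inclusion says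
  \<open>(y - x\<^sub>n\<^sub>+\<^sub>1) / \<eta> \<in> \<partial>F(x\<^sub>n\<^sub>+\<^sub>1)\<close>. So existence and uniqueness of
  the sequence reduce to the resolvent \<open>(I + \<eta> \<partial>F)\<inverse>\<close> being a well-defined map on the whole
  space. It is single-valued because \<open>\<partial>F\<close> is monotone. It is defined everywhere because its value
  at \<open>y\<close> is the minimiser of \<open>F(x) + \<parallel>x - y\<parallel>\<^sup>2 / (2\<eta>)\<close>: a subgradient of \<open>F\<close> at any
  point bounds this functional below, the quadratic term makes minimising sequences Cauchy
  (parallelogram law), and lower semicontinuity passes to the limit
  (\<open>proximal_minimizer_exists\<close>, \<open>proximal_minimizer_subgradient\<close>).

  The energy estimate adds two first-order inequalities at the increment
  \<open>x\<^sub>n\<^sub>+\<^sub>1 - x\<^sub>n = \<tau> v\<^sub>n - \<eta> g\<^sub>n\<close>: convexity of \<open>F\<close> is used at the new point and concavity of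
  \<open>G\<close> at the old one, which is why \<open>F\<close> is treated implicitly and \<open>G\<close> explicitly. Together they
  bound the change of \<open>F + G\<close> by \<open>\<tau> \<langle>g\<^sub>n, v\<^sub>n\<rangle> - \<eta> \<parallel>g\<^sub>n\<parallel>\<^sup>2\<close>, and the mixed term cancels
  against the one in \<open>\<parallel>v\<^sub>n - \<tau> g\<^sub>n\<parallel>\<^sup>2 / 2\<close>.
\<close>

section \<open>Convex and concave functions to first order\<close>

text \<open>The weak topology is coarser than the norm topology, because bounded linear functionals are
  norm continuous.\<close>

lemma openin_weak_topology_imp_open:
  assumes "openin weak_topology S"
  shows "open S"
proof -
  have "generate_topology_on {f -` U | (f :: 'a \<Rightarrow> real) U. bounded_linear f \<and> open U} S"
    using assms unfolding weak_topology_def openin_topology_generated_by_iff .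
  then show ?thesis
  proof induction
    case (Basis s)
    then obtain f :: "'a \<Rightarrow> real" and U where "s = f -` U" "bounded_linear f" "open U"
      by blast
    then show ?case
      by (simp add: open_vimage linear_continuous_on)
  qed auto
qed

lemma closed_sublevel_of_weakly_lsc:
  fixes F :: "'a::real_normed_vector \<Rightarrow> ereal"
  assumes "lower_semicontinuous_map weak_topology F"
  shows "closed {x. F x \<le> c}"
proof -
  have "(UNIV :: 'a set) = (\<lambda>x. 0::real) -` UNIV" by auto
  then have "openin weak_topology (UNIV :: 'a set)"
    unfolding weak_topology_def
    by (intro topology_generated_by_Basis) (auto intro: bounded_linear_zero)
  then have "topspace weak_topology = (UNIV :: 'a set)"
    using openin_subset by blast
  then have "open {x. c < F x}"
    using assms openin_weak_topology_imp_open
    unfolding lower_semicontinuous_map_def by fastforce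
  moreover have "- {x. F x \<le> c} = {x. c < F x}" by auto
  ultimately show ?thesis by (simp add: closed_def)
qed

text \<open>By concavity the difference quotients of \<open>G\<close> from \<open>x\<close> towards \<open>z\<close> dominate their value
  at \<open>t = 1\<close>; letting \<open>t\<close> tend to \<open>0\<close> from the right turns the Gateaux gradient into a
  supergradient.\<close>

lemma concave_le_gateaux_linearization:
  assumes "concave_on UNIV G" and "has_gateaux_gradient G d x"
  shows "G z \<le> G x + inner d (z - x)"
proof -
  have lim: "((\<lambda>t. (G (x + t *\<^sub>R (z - x)) - G x) / t) \<longlongrightarrow> inner d (z - x)) (at_right 0)"
    using assms(2) unfolding has_gateaux_gradient_def
    by (meson filterlim_at_split)
  have "\<forall>\<^sub>F t in at_right 0. G z - G x \<le> (G (x + t *\<^sub>R (z - x)) - G x) / t"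
  proof (rule eventually_at_rightI[of 0 1])
    fix t :: real assume t: "t \<in> {0<..<1}"
    have "(1 - t) * G x + t * G z \<le> G ((1 - t) *\<^sub>R x + t *\<^sub>R z)"
      using concave_onD[OF assms(1), of t x z] t by auto
    also have "(1 - t) *\<^sub>R x + t *\<^sub>R z = x + t *\<^sub>R (z - x)"
      by (simp add: algebra_simps)
    finally show "G z - G x \<le> (G (x + t *\<^sub>R (z - x)) - G x) / t"
      using t by (simp add: field_simps)
  qed simp
  from tendsto_lowerbound[OF lim this] show ?thesis by simp
qed

lemma subdifferential_monotone:
  assumes "\<And>x. F x \<noteq> -\<infinity>"
    and "s \<in> subdifferential F x" and "s' \<in> subdifferential F x'"
  shows "inner (s - s') (x - x') \<ge> 0"
proof -
  have fin: "F x \<noteq> \<infinity>" "F x' \<noteq> \<infinity>"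
    using assms(2,3) by (auto simp: subdifferential_def split: if_splits)
  then obtain a b where ab: "F x = ereal a" "F x' = ereal b"
    using assms(1) by (metis ereal_cases)
  have "F x + ereal (inner s (x' - x)) \<le> F x'" "F x' + ereal (inner s' (x - x')) \<le> F x"
    using assms(2,3) fin by (auto simp: subdifferential_def)
  then show ?thesis
    by (simp add: ab inner_diff algebra_simps)
qed

section \<open>The resolvent of the subdifferential\<close>

lemma ereal_convex_finite_combination:
  assumes "ereal_convex F" "\<And>x. F x \<noteq> -\<infinity>"
    and "F a = ereal \<alpha>" "F b = ereal \<beta>" "0 < t" "t < 1"
  obtains \<gamma> where "F ((1 - t) *\<^sub>R a + t *\<^sub>R b) = ereal \<gamma>" "\<gamma> \<le> (1 - t) * \<alpha> + t * \<beta>"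
proof -
  have "F ((1 - t) *\<^sub>R a + t *\<^sub>R b) \<le> ereal ((1 - t) * \<alpha> + t * \<beta>)"
    using assms unfolding ereal_convex_def
    by (metis plus_ereal.simps(1) times_ereal.simps(1))
  then show ?thesis
    using that assms(2) by (cases "F ((1 - t) *\<^sub>R a + t *\<^sub>R b)") auto
qed

text \<open>The parallelogram law gives the functional at the midpoint of two points \<open>a\<close>, \<open>b\<close> a gain of
  \<open>\<parallel>a - b\<parallel>\<^sup>2 / (8\<eta>)\<close> over the mean of the values. Two points whose values exceed the infimum by at
  most \<open>\<epsilon>\<close> are therefore at squared distance at most \<open>8\<eta>\<epsilon>\<close>, so that completeness replaces
  weak compactness.\<close>

lemma proximal_minimizer_exists:
  fixes F :: "'a::{real_inner, complete_space} \<Rightarrow> ereal"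
  assumes F_range: "\<And>x. F x \<noteq> -\<infinity>" and conv: "ereal_convex F"
    and closed: "\<And>c. closed {x. F x \<le> ereal c}"
    and subgrad: "s \<in> subdifferential F z" and eta: "\<eta> > 0"
  obtains p \<pi> where "F p = ereal \<pi>"
    "\<And>x \<alpha>. F x = ereal \<alpha> \<Longrightarrow>
       \<pi> + (norm (p - y))\<^sup>2 / (2 * \<eta>) \<le> \<alpha> + (norm (x - y))\<^sup>2 / (2 * \<eta>)"
proof -
  define q where "q x = (norm (x - y))\<^sup>2 / (2 * \<eta>)" for x
  define V where "V = {\<alpha> + q x | \<alpha> x. F x = ereal \<alpha>}"
  define m where "m = Inf V"
  obtain \<zeta> where \<zeta>: "F z = ereal \<zeta>"
    using subgrad F_range[of z] by (cases "F z") (auto simp: subdifferential_def)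
  have minorant: "\<zeta> + inner s (x - z) \<le> \<alpha>" if "F x = ereal \<alpha>" for x \<alpha>
    using subgrad that \<zeta> by (auto simp: subdifferential_def dest: spec[of _ x])
  have V_ne: "V \<noteq> {}" using \<zeta> by (auto simp: V_def)
  have V_bdd: "bdd_below V"
  proof
    fix r assume "r \<in> V"
    then obtain \<alpha> x where x: "r = \<alpha> + q x" "F x = ereal \<alpha>" by (auto simp: V_def)
    \<comment> \<open>completing the square around the minimiser of the affine minorant plus the quadratic\<close>
    have "0 \<le> (norm ((x - y) + \<eta> *\<^sub>R s))\<^sup>2 / (2 * \<eta>)" using eta by simp
    also have "\<dots> = q x + inner s (x - y) + \<eta> / 2 * (norm s)\<^sup>2"
      using eta unfolding q_def power2_norm_eq_inner inner_add inner_scaleR_left inner_scaleR_right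
        inner_commute[of s "x - y"]
      by (simp add: field_simps)
    finally have "0 \<le> q x + inner s (x - z) + inner s (z - y) + \<eta> / 2 * (norm s)\<^sup>2"
      by (simp add: inner_diff)
    then show "\<zeta> - inner s (z - y) - \<eta> / 2 * (norm s)\<^sup>2 \<le> r"
      using minorant[OF x(2)] x(1) by simp
  qed
  have m_le: "m \<le> \<alpha> + q x" if "F x = ereal \<alpha>" for x \<alpha>
    unfolding m_def using that by (intro cInf_lower V_bdd) (auto simp: V_def)
  have "\<exists>x \<alpha>. F x = ereal \<alpha> \<and> \<alpha> + q x < m + 1 / real (Suc n)" for n
  proof -
    have "Inf V < m + 1 / real (Suc n)" by (simp add: m_def)
    then show ?thesis using cInf_lessD[OF V_ne] unfolding V_def by blast
  qed
  then obtain X A where XA: "\<And>n. F (X n) = ereal (A n)" "\<And>n. A n + q (X n) < m + 1 / real (Suc n)"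
    by metis
  have close: "(norm (X i - X j))\<^sup>2 \<le> 8 * \<eta> / real (Suc N)" if "N \<le> i" "N \<le> j" for i j N
  proof -
    define c where "c = (1 - 1/2) *\<^sub>R X i + (1/2) *\<^sub>R X j"
    obtain \<gamma> where \<gamma>: "F c = ereal \<gamma>" "\<gamma> \<le> (1 - 1/2) * A i + 1/2 * A j"
      unfolding c_def
      using ereal_convex_finite_combination[OF conv F_range XA(1)[of i] XA(1)[of j], of "1/2"] by auto
    define a where "a = X i - y"
    define b where "b = X j - y"
    have c_minus: "c - y = (1/2) *\<^sub>R (a + b)"
      by (simp add: c_def a_def b_def algebra_simps flip: scaleR_2)
    have ab: "X i - X j = a - b" by (simp add: a_def b_def)
    have "(norm (X i - X j))\<^sup>2 = 8 * \<eta> * ((q (X i) + q (X j)) / 2 - q c)"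
      unfolding q_def c_minus ab a_def[symmetric] b_def[symmetric] power2_norm_eq_inner
      using eta by (simp add: inner_add inner_diff inner_commute field_simps)
    also have "\<dots> \<le> 8 * \<eta> * (1 / real (Suc N))"
    proof (rule mult_left_mono)
      have "1 / real (Suc i) \<le> 1 / real (Suc N)" "1 / real (Suc j) \<le> 1 / real (Suc N)"
        using that by (auto simp: frac_le)
      then show "(q (X i) + q (X j)) / 2 - q c \<le> 1 / real (Suc N)"
        using m_le[OF \<gamma>(1)] \<gamma>(2) XA(2)[of i] XA(2)[of j] by argo
    qed (use eta in simp)
    finally show ?thesis by simp
  qed
  have "Cauchy X"
  proof (rule metric_CauchyI)
    fix e :: real assume e: "0 < e"
    have "(\<lambda>n. 8 * \<eta> * (1 / real (Suc n))) \<longlonglongrightarrow> 8 * \<eta> * 0"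
      by (intro tendsto_mult tendsto_const LIMSEQ_Suc lim_1_over_n)
    then have "\<forall>\<^sub>F n in sequentially. 8 * \<eta> * (1 / real (Suc n)) < e\<^sup>2"
      using e by (intro order_tendstoD(2)[of _ "8 * \<eta> * 0"]) auto
    then obtain N where N: "8 * \<eta> / real (Suc N) < e\<^sup>2"
      by (auto simp: eventually_sequentially)
    have "dist (X i) (X j) < e" if "N \<le> i" "N \<le> j" for i j
    proof (rule power_less_imp_less_base[where n = 2])
      show "(dist (X i) (X j))\<^sup>2 < e\<^sup>2"
        using close[OF that] N by (simp add: dist_norm)
    qed (use e in simp)
    then show "\<exists>N. \<forall>i\<ge>N. \<forall>j\<ge>N. dist (X i) (X j) < e" by blast
  qed
  then obtain p where p: "X \<longlonglongrightarrow> p"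
    using Cauchy_convergent convergent_def by blast
  have "(\<lambda>n. m + 1 / real (Suc n) - q (X n)) \<longlonglongrightarrow> m + 0 - q p"
    unfolding q_def using eta
    by (intro tendsto_intros LIMSEQ_Suc lim_1_over_n p) auto
  then have lim: "(\<lambda>n. m + 1 / real (Suc n) - q (X n)) \<longlonglongrightarrow> m - q p" by simp
  have Fp: "F p \<le> ereal c" if "m - q p < c" for c
  proof -
    have "\<forall>\<^sub>F n in sequentially. X n \<in> {x. F x \<le> ereal c}"
      using order_tendstoD(2)[OF lim that]
    proof eventually_elim
      case (elim n)
      then show ?case using XA(1)[of n] XA(2)[of n] by simp
    qed
    then have "p \<in> {x. F x \<le> ereal c}"
      using Lim_in_closed_set[OF closed _ _ p] by simp
    then show ?thesis by simp
  qed
  obtain \<pi> where \<pi>: "F p = ereal \<pi>"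
    using Fp[of "m - q p + 1"] F_range[of p] by (cases "F p") auto
  have "\<pi> \<le> m - q p"
    using Fp \<pi> by (auto intro!: dense_ge[of "m - q p" \<pi>])
  then have "\<pi> + q p \<le> \<alpha> + q x" if "F x = ereal \<alpha>" for x \<alpha>
    using m_le[OF that] by simp
  with \<pi> show ?thesis using that unfolding q_def by blast
qed

text \<open>Fermat's rule. Moving from the minimiser \<open>p\<close> a fraction \<open>t\<close> of the way to \<open>x\<close> changes the
  quadratic by its derivative times \<open>t\<close> plus a term of order \<open>t\<^sup>2\<close>, while convexity bounds the
  change of \<open>F\<close> by \<open>t (F x - F p)\<close>; dividing by \<open>t\<close> and letting \<open>t\<close> tend to \<open>0\<close> removes the
  second-order term.\<close>

lemma proximal_minimizer_subgradient:
  assumes F_range: "\<And>x. F x \<noteq> -\<infinity>" and conv: "ereal_convex F" and eta: "\<eta> > 0"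
    and Fp: "F p = ereal \<pi>"
    and min: "\<And>x \<alpha>. F x = ereal \<alpha> \<Longrightarrow>
       \<pi> + (norm (p - y))\<^sup>2 / (2 * \<eta>) \<le> \<alpha> + (norm (x - y))\<^sup>2 / (2 * \<eta>)"
  shows "(y - p) /\<^sub>R \<eta> \<in> subdifferential F p"
proof -
  have "F p + ereal (inner ((y - p) /\<^sub>R \<eta>) (x - p)) \<le> F x" for x
  proof (cases "F x")
    case (real \<alpha>)
    define C where "C = (norm (x - p))\<^sup>2 / (2 * \<eta>)"
    have bound: "\<pi> + inner ((y - p) /\<^sub>R \<eta>) (x - p) - \<alpha> \<le> t * C" if t: "t \<in> {0<..<1}" for t
    proof -
      obtain \<gamma> where \<gamma>: "F ((1 - t) *\<^sub>R p + t *\<^sub>R x) = ereal \<gamma>" "\<gamma> \<le> (1 - t) * \<pi> + t * \<alpha>"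
        using ereal_convex_finite_combination[OF conv F_range Fp real, of t] t by auto
      have "(1 - t) *\<^sub>R p + t *\<^sub>R x - y = (p - y) + t *\<^sub>R (x - p)"
        by (simp add: algebra_simps)
      then have expand: "(norm ((1 - t) *\<^sub>R p + t *\<^sub>R x - y))\<^sup>2
          = (norm (p - y))\<^sup>2 - 2 * t * inner (y - p) (x - p) + t\<^sup>2 * (norm (x - p))\<^sup>2"
        unfolding power2_norm_eq_inner
        by (simp add: inner_add inner_diff inner_commute power2_eq_square algebra_simps)
      have "(norm ((1 - t) *\<^sub>R p + t *\<^sub>R x - y))\<^sup>2 / (2 * \<eta>)
          = (norm (p - y))\<^sup>2 / (2 * \<eta>) - t * inner ((y - p) /\<^sub>R \<eta>) (x - p) + t * (t * C)"
        unfolding expand C_def inner_scaleR_left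
        using eta by (simp add: field_simps power2_eq_square)
      then have "t * (\<pi> + inner ((y - p) /\<^sub>R \<eta>) (x - p) - \<alpha>) \<le> t * (t * C)"
        using min[OF \<gamma>(1)] \<gamma>(2) by (simp add: algebra_simps)
      then show ?thesis using t by simp
    qed
    have "((\<lambda>t. t * C) \<longlongrightarrow> 0 * C) (at_right 0)"
      by (intro tendsto_intros)
    from tendsto_lowerbound[OF this eventually_at_rightI[of 0 1, OF bound]]
    show ?thesis by (simp add: Fp real)
  qed (use F_range in auto)
  then show ?thesis using Fp by (simp add: subdifferential_def)
qed

lemma resolvent_ex1:
  fixes F :: "'a::{real_inner, complete_space} \<Rightarrow> ereal"
  assumes F_range: "\<And>x. F x \<noteq> -\<infinity>" and conv: "ereal_convex F"
    and closed: "\<And>c. closed {x. F x \<le> ereal c}"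
    and dom: "subdifferential_domain F \<noteq> {}" and eta: "\<eta> > 0"
  shows "\<exists>!p. (y - p) /\<^sub>R \<eta> \<in> subdifferential F p"
proof (rule ex_ex1I)
  obtain z s where "s \<in> subdifferential F z"
    using dom by (auto simp: subdifferential_domain_def)
  from proximal_minimizer_exists[OF F_range conv closed this eta]
  show "\<exists>p. (y - p) /\<^sub>R \<eta> \<in> subdifferential F p"
    using proximal_minimizer_subgradient[OF F_range conv eta] by metis
next
  fix p p'
  assume "(y - p) /\<^sub>R \<eta> \<in> subdifferential F p" "(y - p') /\<^sub>R \<eta> \<in> subdifferential F p'"
  from subdifferential_monotone[OF F_range this]
  have "0 \<le> inner ((y - p) /\<^sub>R \<eta> - (y - p') /\<^sub>R \<eta>) (p - p')" .
  also have "(y - p) /\<^sub>R \<eta> - (y - p') /\<^sub>R \<eta> = - ((p - p') /\<^sub>R \<eta>)"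
    by (simp add: algebra_simps)
  finally have "inner (p - p') (p - p') \<le> 0"
    using eta by (simp add: zero_le_mult_iff mult_le_0_iff)
  then have "inner (p - p') (p - p') = 0" using inner_ge_zero[of "p - p'"] by linarith
  then show "p = p'" by simp
qed

section \<open>The time-stepping scheme\<close>

text \<open>The scheme prescribes \<open>v\<^sub>n\<^sub>+\<^sub>1\<close> explicitly in terms of \<open>x\<^sub>n\<^sub>+\<^sub>1\<close>, and \<open>x\<^sub>n\<^sub>+\<^sub>1\<close> as the
  resolvent at a point known from step \<open>n\<close>. It is thus an ordinary recursion for the pairs.\<close>

lemma time_stepping_scheme_ex1:
  assumes resolvent: "\<And>y. \<exists>!p. (y - p) /\<^sub>R \<eta> \<in> subdifferential F p" and eta: "\<eta> > 0"
  shows "\<exists>!z. z 0 = (x0, v0) \<and> time_stepping_scheme F gradG \<eta> \<tau> \<rho> (fst \<circ> z) (snd \<circ> z)"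
proof -
  define J where "J y = (THE p. (y - p) /\<^sub>R \<eta> \<in> subdifferential F p)" for y
  have J: "(y - p) /\<^sub>R \<eta> \<in> subdifferential F p \<longleftrightarrow> p = J y" for y p
    unfolding J_def using theI'[OF resolvent[of y]] resolvent[of y] by metis
  define step where "step = (\<lambda>(x, v). let x' = J (x + \<tau> *\<^sub>R v - \<eta> *\<^sub>R gradG x) in
      (x', \<rho> *\<^sub>R (v - \<tau> *\<^sub>R (gradG x + ((x + \<tau> *\<^sub>R v - x') /\<^sub>R \<eta> - gradG x)))))"
  have "(x + \<tau> *\<^sub>R v - x') /\<^sub>R \<eta> - gradG x = ((x + \<tau> *\<^sub>R v - \<eta> *\<^sub>R gradG x) - x') /\<^sub>R \<eta>" for x v x'
    using eta by (simp add: algebra_simps)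
  then have "(x + \<tau> *\<^sub>R v - x') /\<^sub>R \<eta> - gradG x \<in> subdifferential F x'
      \<longleftrightarrow> x' = J (x + \<tau> *\<^sub>R v - \<eta> *\<^sub>R gradG x)" for x v x'
    using J by presburger
  then have scheme: "time_stepping_scheme F gradG \<eta> \<tau> \<rho> (fst \<circ> z) (snd \<circ> z)
      \<longleftrightarrow> (\<forall>n. z (Suc n) = step (z n))" for z
    unfolding time_stepping_scheme_def scheme_gradient_def scheme_subgradient_def step_def
    by (auto simp: prod_eq_iff Let_def case_prod_unfold)
  show ?thesis
  proof (rule ex1I[of _ "rec_nat (x0, v0) (\<lambda>_. step)"])
    fix z assume "z 0 = (x0, v0) \<and> time_stepping_scheme F gradG \<eta> \<tau> \<rho> (fst \<circ> z) (snd \<circ> z)"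
    then have "z n = rec_nat (x0, v0) (\<lambda>_. step) n" for n
      by (induction n) (auto simp: scheme)
    then show "z = rec_nat (x0, v0) (\<lambda>_. step)" by blast
  qed (simp add: scheme)
qed

lemma energy_step:
  assumes F_range: "\<And>x. F x \<noteq> -\<infinity>"
    and G_concave: "concave_on UNIV G"
    and G_grad: "\<And>x. has_gateaux_gradient G (gradG x) x"
    and eta: "\<eta> > 0" and rho: "0 < \<rho>"
    and scheme: "time_stepping_scheme F gradG \<eta> \<tau> \<rho> x v"
  shows "total_energy F G \<rho> x v (Suc n) \<le>
           total_energy F G \<rho> x v n
           - ereal (1 / 2 * (1 / \<rho>\<^sup>2 - 1) * (norm (v n))\<^sup>2)
           + ereal ((\<tau>\<^sup>2 / 2 - \<eta>) * (norm (scheme_gradient gradG \<eta> \<tau> x v n))\<^sup>2)"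
proof -
  define s where "s = scheme_subgradient gradG \<eta> \<tau> x v n"
  define g where "g = scheme_gradient gradG \<eta> \<tau> x v n"
  define x' where "x' = x (Suc n)"
  have s: "s \<in> subdifferential F x'" and v': "v (Suc n) = \<rho> *\<^sub>R (v n - \<tau> *\<^sub>R g)"
    using scheme unfolding time_stepping_scheme_def s_def g_def x'_def by auto
  have g: "g = gradG (x n) + s" by (simp add: g_def s_def scheme_gradient_def)
  have "g = (x n + \<tau> *\<^sub>R v n - x') /\<^sub>R \<eta>"
    by (simp add: g s_def scheme_subgradient_def x'_def)
  then have incr: "x' - x n = \<tau> *\<^sub>R v n - \<eta> *\<^sub>R g"
    using eta by simp
  obtain \<beta> where \<beta>: "F x' = ereal \<beta>"
    using s F_range[of x'] by (cases "F x'") (auto simp: subdifferential_def)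
  show ?thesis
  proof (cases "F (x n)")
    case (real \<alpha>)
    have "\<beta> + inner s (x n - x') \<le> \<alpha>"
      using s real \<beta> by (auto simp: subdifferential_def dest: spec[of _ "x n"])
    moreover have "G x' \<le> G (x n) + inner (gradG (x n)) (x' - x n)"
      by (rule concave_le_gateaux_linearization[OF G_concave G_grad])
    ultimately have "\<beta> + G x' \<le> \<alpha> + G (x n) + inner g (x' - x n)"
      by (simp add: g inner_add inner_diff)
    then have potential: "\<beta> + G x' \<le> \<alpha> + G (x n) + \<tau> * inner g (v n) - \<eta> * (norm g)\<^sup>2"
      unfolding incr by (simp add: inner_diff power2_norm_eq_inner)
    \<comment> \<open>the damping factor \<open>\<rho>\<close> of the velocity cancels against the weight in the energy\<close>
    have "1 / (2 * \<rho>\<^sup>2) * (norm (v (Suc n)))\<^sup>2 = (norm (v n - \<tau> *\<^sub>R g))\<^sup>2 / 2"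
      using rho unfolding v' by (simp add: power_mult_distrib)
    also have "\<dots> = (norm (v n))\<^sup>2 / 2 - \<tau> * inner g (v n) + \<tau>\<^sup>2 / 2 * (norm g)\<^sup>2"
      unfolding power2_norm_eq_inner
      by (simp add: inner_diff inner_commute power2_eq_square field_simps)
    finally have kinetic: "1 / (2 * \<rho>\<^sup>2) * (norm (v (Suc n)))\<^sup>2
        = (norm (v n))\<^sup>2 / 2 - \<tau> * inner g (v n) + \<tau>\<^sup>2 / 2 * (norm g)\<^sup>2" .
    have "\<beta> + G x' + 1 / (2 * \<rho>\<^sup>2) * (norm (v (Suc n)))\<^sup>2
        \<le> \<alpha> + G (x n) + (norm (v n))\<^sup>2 / 2 + (\<tau>\<^sup>2 / 2 - \<eta>) * (norm g)\<^sup>2"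
      unfolding kinetic using potential by (simp add: algebra_simps)
    also have "\<dots> = \<alpha> + G (x n) + 1 / (2 * \<rho>\<^sup>2) * (norm (v n))\<^sup>2
        - 1 / 2 * (1 / \<rho>\<^sup>2 - 1) * (norm (v n))\<^sup>2 + (\<tau>\<^sup>2 / 2 - \<eta>) * (norm g)\<^sup>2"
      by (simp add: algebra_simps)
    finally show ?thesis
      using real \<beta> by (simp add: total_energy_def g_def[symmetric] x'_def[symmetric])
    \<comment> \<open>an infinite value of \<open>F\<close> makes the right-hand side \<open>\<infinity>\<close>; this occurs at most for \<open>n = 0\<close>\<close>
  qed (use F_range in \<open>auto simp: total_energy_def\<close>)
qed

theorem theorem4p2:
  fixes F :: "'a::{real_inner, complete_space} \<Rightarrow> ereal"
    and G :: "'a \<Rightarrow> real" and gradG :: "'a \<Rightarrow> 'a"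
    and x0 v0 :: 'a and \<eta> \<tau> \<rho> :: real
  assumes separable: "separable_space (euclidean :: 'a topology)"
    and F_range: "\<And>x. F x \<noteq> -\<infinity>"
    and F_lsc: "lower_semicontinuous_map weak_topology F"
    and F_convex: "ereal_convex F"
    and dom_dense: "closure (subdifferential_domain F) = UNIV"
    and G_concave: "concave_on UNIV G"
    and G_cont: "continuous_on UNIV G"
    and G_grad: "\<And>x. has_gateaux_gradient G (gradG x) x"
    and eta: "\<eta> > 0" and tau: "\<tau> > 0" and rho: "0 < \<rho>" "\<rho> \<le> 1"
  shows "(\<exists>!z :: nat \<Rightarrow> 'a \<times> 'a.
            z 0 = (x0, v0) \<and> time_stepping_scheme F gradG \<eta> \<tau> \<rho> (fst \<circ> z) (snd \<circ> z)) \<and>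
         (\<forall>x v. x 0 = x0 \<and> v 0 = v0 \<and> time_stepping_scheme F gradG \<eta> \<tau> \<rho> x v \<longrightarrow>
            (\<forall>n. total_energy F G \<rho> x v (Suc n) \<le>
                   total_energy F G \<rho> x v n
                   - ereal (1 / 2 * (1 / \<rho>\<^sup>2 - 1) * (norm (v n))\<^sup>2)
                   + ereal ((\<tau>\<^sup>2 / 2 - \<eta>) * (norm (scheme_gradient gradG \<eta> \<tau> x v n))\<^sup>2)) \<and>
            (\<eta> \<ge> \<tau>\<^sup>2 / 2 \<longrightarrow> decseq (total_energy F G \<rho> x v)))"
proof (intro conjI allI impI)
  have "closed {x. F x \<le> ereal c}" for c
    by (rule closed_sublevel_of_weakly_lsc[OF F_lsc])
  moreover have "subdifferential_domain F \<noteq> {}"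
    using dom_dense by auto
  ultimately have "\<exists>!p. (y - p) /\<^sub>R \<eta> \<in> subdifferential F p" for y
    by (intro resolvent_ex1 F_range F_convex eta)
  then show "\<exists>!z. z 0 = (x0, v0) \<and> time_stepping_scheme F gradG \<eta> \<tau> \<rho> (fst \<circ> z) (snd \<circ> z)"
    by (rule time_stepping_scheme_ex1[OF _ eta])
next
  fix x v n
  assume "x 0 = x0 \<and> v 0 = v0 \<and> time_stepping_scheme F gradG \<eta> \<tau> \<rho> x v"
  then show "total_energy F G \<rho> x v (Suc n) \<le>
      total_energy F G \<rho> x v n
      - ereal (1 / 2 * (1 / \<rho>\<^sup>2 - 1) * (norm (v n))\<^sup>2)
      + ereal ((\<tau>\<^sup>2 / 2 - \<eta>) * (norm (scheme_gradient gradG \<eta> \<tau> x v n))\<^sup>2)"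
    using energy_step[where F = F, OF F_range G_concave G_grad eta rho(1)] by blast
next
  fix x v
  assume scheme: "x 0 = x0 \<and> v 0 = v0 \<and> time_stepping_scheme F gradG \<eta> \<tau> \<rho> x v"
    and step: "\<tau>\<^sup>2 / 2 \<le> \<eta>"
  have "1 \<le> 1 / \<rho>\<^sup>2" using rho by (simp add: power_le_one)
  then have friction: "0 \<le> 1 / 2 * (1 / \<rho>\<^sup>2 - 1) * (norm (v n))\<^sup>2" for n by simp
  have dissipation: "(\<tau>\<^sup>2 / 2 - \<eta>) * (norm w)\<^sup>2 \<le> 0" for w :: 'a
    using step by (intro mult_nonpos_nonneg) auto
  have absorb: "e - ereal a + ereal b \<le> e" if "0 \<le> a" "b \<le> 0" for e a b
    using that by (cases e) auto
  show "decseq (total_energy F G \<rho> x v)"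
  proof (rule decseq_SucI)
    fix n
    have "time_stepping_scheme F gradG \<eta> \<tau> \<rho> x v" using scheme by blast
    from order_trans[OF energy_step[where F = F, OF F_range G_concave G_grad eta rho(1) this]
        absorb[OF friction dissipation]]
    show "total_energy F G \<rho> x v (Suc n) \<le> total_energy F G \<rho> x v n" .
  qed
qed

end
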